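(* Consider the 2-bus power system, with state $(\omega_1,\omega_2,\delta)\in\mathbb{R}^3$, $$\begin{aligned}M_1\dot\omega_1(t)&=p_1-R_1\omega_1(t)-a\sin(\delta(t)+\varphi),\\ M_2\dot\omega_2(t)&=p_2-R_2\omega_2(t)+a\sin(\delta(t)-\varphi),\\ \dot\delta(t)&=\omega_2(t)-\omega_1(t),\end{aligned}$$ where $R_1,R_2>0$, $M_1,M_2>0$, $p_1,p_2>0$, $a>0$, and $\varphi\in(-\pi/2,\pi/2)$. Suppose that $a>\max\{M_1,M_2\}$. If $$3a^2\left(1+|\cos(2\varphi)|\right)<\frac{\min_{i}M_i}{\max_{i}M_i}\ \min_{i}\frac{R_i^2}{2}$$ (minima and maximum over $i\in\{1,2\}$), then the system is $2$-contractive.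
   Context: For $M\in\mathbb{R}^{n\times m}$ and $1\le k\le\min\{n,m\}$, the $k$-multiplicative compound $M^{(k)}$ is the $\binom nk\times\binom mk$ matrix of all $k\times k$ minors of $M$, with row and column index sets ordered lexicographically. A system $\dot x=g(t,x)$ on a state space $\Omega\subseteq\mathbb{R}^n$ (here $\Omega=\mathbb{R}^3$), with Jacobian $J(t,x)=\frac{\partial g}{\partial x}(t,x)$, is $k$-contractive with rate $\eta>0$ with respect to a norm $|\cdot|$ on $\mathbb{R}^{\binom nk}$ if for every solution $x:[s,T]\to\Omega$ ($0\le s<T$) and all solutions $\delta^1,\dots,\delta^k:[s,T]\to\mathbb{R}^n$ of the variational equation $\dot\delta(t)=J(t,x(t))\delta(t)$, the matrix $X(t):=[\delta^1(t)\ \cdots\ \delta^k(t)]\in\mathbb{R}^{n\times k}$ satisfies $|X(t)^{(k)}|\le e^{-\eta(t-s)}|X(s)^{(k)}|$ for all $t\in[s,T]$. The system is called $k$-contractive if this holds for some rate $\eta>0$ and some norm. *)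

theory Defs
  imports
    "HOL-Analysis.Analysis"
    "HOL-Library.List_Lexorder"
    "HOL-Library.Numeral_Type"
    "Jordan_Normal_Form.Determinant"
    "Jordan_Normal_Form.DL_Submatrix"
begin

no_notation Matrix.vec_index (infixl "$" 100)

text \<open>States live in \<open>real ^ 'n\<close>. The compound of an \<open>n \<times> k\<close> matrix has
  \<open>n choose k\<close> rows, a size that no index type can express for varying \<open>k\<close>, so the matrices whose
  compounds are taken, and the vectors of length \<open>n choose k\<close>, are those of
  \<^theory>\<open>Jordan_Normal_Form.Matrix\<close>, indexed from 0.\<close>

text \<open>The \<open>k\<close>-subsets of \<open>{0, \<dots>, n - 1}\<close> as increasing lists. The order on lists is the
  lexicographic one of \<^theory>\<open>HOL-Library.List_Lexorder\<close>.\<close>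

definition lex_subsets :: "nat \<Rightarrow> nat \<Rightarrow> nat list list" where
  "lex_subsets n k =
     sorted_list_of_set {l. sorted_wrt (<) l \<and> set l \<subseteq> {..<n} \<and> length l = k}"

definition mult_compound :: "nat \<Rightarrow> real mat \<Rightarrow> real mat" where
  "mult_compound k M =
     Matrix.mat (dim_row M choose k) (dim_col M choose k)
       (\<lambda>(i, j). Determinant.det
          (submatrix M (set (lex_subsets (dim_row M) k ! i)) (set (lex_subsets (dim_col M) k ! j))))"

definition is_norm_on_carrier_vec :: "nat \<Rightarrow> (real Matrix.vec \<Rightarrow> real) \<Rightarrow> bool" where
  "is_norm_on_carrier_vec N \<nu> \<longleftrightarrow>
     (\<forall>v \<in> carrier_vec N. 0 \<le> \<nu> v) \<and>
     (\<forall>v \<in> carrier_vec N. \<nu> v = 0 \<longleftrightarrow> v = 0\<^sub>v N) \<and>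
     (\<forall>c. \<forall>v \<in> carrier_vec N. \<nu> (c \<cdot>\<^sub>v v) = \<bar>c\<bar> * \<nu> v) \<and>
     (\<forall>v \<in> carrier_vec N. \<forall>w \<in> carrier_vec N. \<nu> (v + w) \<le> \<nu> v + \<nu> w)"

lemma lex_subsets_3_2: "lex_subsets 3 2 = [[0, 1], [0, 2], [1, 2]]"
proof -
  have "{l. sorted_wrt (<) l \<and> set l \<subseteq> {..<3::nat} \<and> length l = 2} = set [[0, 1], [0, 2], [1, 2]]"
    by (auto simp: length_Suc_conv numeral_2_eq_2 numeral_3_eq_3 less_Suc_eq)
  then show ?thesis
    unfolding lex_subsets_def
    using sorted_list_of_set.idem_if_sorted_distinct[of "[[0, 1], [0, 2], [1, 2 :: nat]]"] by simp
qed

lemma sorted_list_of_set_3: "sorted_list_of_set (UNIV :: 3 set) = [0, 1, 2]"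
proof -
  have "x = 0 \<or> x = 1 \<or> x = 2" for x :: 3
    using exhaust_3[of x] by auto
  then have "(UNIV :: 3 set) = set [0, 1, 2]"
    by auto
  moreover have "(0::3) < 1" "(1::3) < 2" "(0::3) < 2"
    by (simp_all add: less_bit1_def bit1.Rep_0 bit1.Rep_1 bit1.Rep_numeral)
  ultimately show ?thesis
    using sorted_list_of_set.idem_if_sorted_distinct[of "[0, 1, 2 :: 3]"]
    by (simp add: order.strict_implies_order order.strict_implies_not_eq)
qed

text \<open>Column \<open>j\<close> is \<open>\<delta> j\<close>; rows follow the order of the index type. In the type \<open>3\<close> this order is
  \<open>0 < 1 < 2\<close>, and the literal \<open>3\<close> denotes \<open>0\<close>.\<close>

definition mat_of_states :: "nat \<Rightarrow> (nat \<Rightarrow> real ^ 'n::{finite,linorder}) \<Rightarrow> real mat" where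
  "mat_of_states k \<delta> =
     Matrix.mat CARD('n) k (\<lambda>(i, j). \<delta> j $ (sorted_list_of_set (UNIV :: 'n set) ! i))"

definition is_solution_on ::
  "(real \<Rightarrow> real ^ 'n \<Rightarrow> real ^ 'n) \<Rightarrow> (real ^ 'n) set \<Rightarrow> real \<Rightarrow> real \<Rightarrow> (real \<Rightarrow> real ^ 'n) \<Rightarrow> bool" where
  "is_solution_on g \<Omega> s T x \<longleftrightarrow>
     (\<forall>t \<in> {s..T}. x t \<in> \<Omega> \<and> (x has_vector_derivative g t (x t)) (at t within {s..T}))"

text \<open>Meaningful when every \<open>g t\<close> is differentiable at the points of \<open>\<Omega>\<close>, since
  \<^const>\<open>jacobian\<close> is arbitrary elsewhere. The compound of the \<open>n \<times> k\<close> matrix of variational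
  solutions has a single column, which is the vector measured by \<open>\<nu>\<close>.\<close>

definition k_contractive_with ::
  "nat \<Rightarrow> (real \<Rightarrow> real ^ 'n::{finite,linorder} \<Rightarrow> real ^ 'n::{finite,linorder}) \<Rightarrow> (real ^ 'n::{finite,linorder}) set \<Rightarrow>
   real \<Rightarrow> (real Matrix.vec \<Rightarrow> real) \<Rightarrow> bool" where
  "k_contractive_with k g \<Omega> \<eta> \<nu> \<longleftrightarrow>
     (\<forall>s T x \<delta>. 0 \<le> s \<longrightarrow> s < T \<longrightarrow> is_solution_on g \<Omega> s T x \<longrightarrow>
        (\<forall>j < k. is_solution_on (\<lambda>t y. jacobian (g t) (at (x t)) *v y) UNIV s T (\<delta> j)) \<longrightarrow>
        (\<forall>t \<in> {s..T}.
           \<nu> (col (mult_compound k (mat_of_states k (\<lambda>j. \<delta> j t))) 0)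
             \<le> exp (- \<eta> * (t - s)) * \<nu> (col (mult_compound k (mat_of_states k (\<lambda>j. \<delta> j s))) 0)))"

definition k_contractive ::
  "nat \<Rightarrow> (real \<Rightarrow> real ^ 'n::{finite,linorder} \<Rightarrow> real ^ 'n::{finite,linorder}) \<Rightarrow> (real ^ 'n::{finite,linorder}) set \<Rightarrow> bool" where
  "k_contractive k g \<Omega> \<longleftrightarrow> 1 \<le> k \<and> k \<le> CARD('n) \<and>
     (\<exists>\<eta> \<nu>. \<eta> > 0 \<and> is_norm_on_carrier_vec (CARD('n) choose k) \<nu> \<and> k_contractive_with k g \<Omega> \<eta> \<nu>)"

text \<open>The state is \<open>(\<omega>\<^sub>1, \<omega>\<^sub>2, \<delta>) = (x $ 0, x $ 1, x $ 2)\<close>.\<close>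

definition two_bus ::
  "real \<Rightarrow> real \<Rightarrow> real \<Rightarrow> real \<Rightarrow> real \<Rightarrow> real \<Rightarrow> real \<Rightarrow> real \<Rightarrow> real ^ 3 \<Rightarrow> real ^ 3" where
  "two_bus M1 M2 R1 R2 p1 p2 a \<phi> x =
     (\<chi> i. if i = 0 then (p1 - R1 * x $ 0 - a * sin (x $ 2 + \<phi>)) / M1
          else if i = 1 then (p2 - R2 * x $ 1 + a * sin (x $ 2 - \<phi>)) / M2
          else x $ 1 - x $ 0)"

end

theory Submission
  imports Defs
begin

text \<open>Write \<open>r\<^sub>i = R\<^sub>i / M\<^sub>i\<close>, \<open>c\<^sub>1 = a cos(\<delta> + \<phi>) / M\<^sub>1\<close> and \<open>c\<^sub>2 = a cos(\<delta> - \<phi>) / M\<^sub>2\<close>. The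
  second compound \<open>(z, u, v)\<close> of two variational solutions satisfies
  \<open>z' = - (r\<^sub>1 + r\<^sub>2) z + c\<^sub>2 u + c\<^sub>1 v\<close>, \<open>u' = z - r\<^sub>1 u\<close>, \<open>v' = z - r\<^sub>2 v\<close>. The weighted Euclidean
  norm with \<open>V = b z\<^sup>2 + u\<^sup>2 + v\<^sup>2\<close>, \<open>b = min M\<^sub>1 M\<^sub>2 / a\<close>, makes both couplings at most one
  (\<open>\<bar>b c\<^sub>i\<bar> \<le> 1\<close>), and the hypothesis gives \<open>b r\<^sub>i\<^sup>2 \<ge> 4\<close>. Splitting the damping of \<open>z\<close> into a part
  \<open>r\<^sub>1\<close> paired with \<open>u\<close> and a part \<open>r\<^sub>2\<close> paired with \<open>v\<close>, completing squares yields
  \<open>V' \<le> - 2 \<eta> V\<close> for \<open>\<eta> = min r\<^sub>1 r\<^sub>2 / 2\<close>.\<close>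

text \<open>Gronwall's inequality by an integrating factor: multiplied by
  \<open>exp (c * (r - s))\<close>, the function \<open>V\<close> becomes nonincreasing.\<close>

lemma decay_of_derivative_le:
  fixes V V' :: "real \<Rightarrow> real"
  assumes deriv: "\<And>t. t \<in> {s..T} \<Longrightarrow> (V has_real_derivative V' t) (at t within {s..T})"
    and le: "\<And>t. t \<in> {s..T} \<Longrightarrow> V' t \<le> - c * V t"
    and t: "t \<in> {s..T}"
  shows "V t \<le> exp (- c * (t - s)) * V s"
proof -
  define W where "W = (\<lambda>r. exp (c * (r - s)) * V r)"
  have W: "(W has_real_derivative exp (c * (r - s)) * (c * V r + V' r)) (at r within {s..T})"
    if "r \<in> {s..T}" for r
    unfolding W_def by (auto intro!: derivative_eq_intros deriv that simp: algebra_simps)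
  have "W t \<le> W s"
  \<comment> \<open>Derivatives at the ends of \<open>{s..T}\<close> are one-sided. Continuity
    covers the endpoints; the sign of the derivative is used on the open interval only, where
    \<open>at r within {s..T}\<close> is \<open>at r\<close>.\<close>
  proof (rule DERIV_nonpos_imp_decreasing_open[where f = W])
    show "s \<le> t" using t by simp
    show "continuous_on {s..t} W"
      by (rule continuous_on_subset[OF DERIV_continuous_on[OF W]]) (use t in auto)
    fix r assume r: "s < r" "r < t"
    then have "at r within {s..T} = at r"
      using t by (intro at_within_interior) (auto simp: interior_atLeastAtMost_real)
    moreover have "exp (c * (r - s)) * (c * V r + V' r) \<le> 0"
      using le[of r] r t by (intro mult_nonneg_nonpos) auto
    ultimately show "\<exists>y. (W has_real_derivative y) (at r) \<and> y \<le> 0"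
      using W[of r] r t by auto
  qed
  then have "exp (- c * (t - s)) * W t \<le> exp (- c * (t - s)) * V s"
    by (simp add: W_def)
  then show ?thesis
    by (simp add: W_def flip: mult.assoc exp_add)
qed

lemma lex_subsets_2_2: "lex_subsets 2 2 = [[0, 1]]"
proof -
  have "{l. sorted_wrt (<) l \<and> set l \<subseteq> {..<2::nat} \<and> length l = 2} = set [[0, 1]]"
    by (auto simp: length_Suc_conv numeral_2_eq_2 less_Suc_eq)
  then show ?thesis
    unfolding lex_subsets_def by simp
qed

lemma pick_doubleton:
  assumes "i < j"
  shows "pick {i, j} 0 = i" "pick {i, j} (Suc 0) = j"
proof -
  show i: "pick {i, j} 0 = i"
    using assms by (auto intro!: Least_equality)
  show "pick {i, j} (Suc 0) = j"
    unfolding pick.simps i[unfolded pick.simps] using assms by (auto intro!: Least_equality)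
qed

lemma det_carrier_mat_2:
  assumes "A \<in> carrier_mat 2 2"
  shows "Determinant.det (A :: 'a::comm_ring_1 mat) =
    A $$ (0, 0) * A $$ (1, 1) - A $$ (0, 1) * A $$ (1, 0)"
proof -
  \<comment> \<open>The remaining 1 x 1 minor sits in the row other than \<open>i\<close>, which is
    \<open>1 - i\<close>.\<close>
  have "Determinant.det (mat_delete A i 0) = A $$ (1 - i, 1)" if "i < 2" for i
    using that assms by (subst det_single) (auto simp: mat_delete_def less_2_cases_iff)
  then show ?thesis
    using laplace_expansion_column[OF assms, of 0]
    by (simp add: cofactor_def numeral_2_eq_2 lessThan_Suc algebra_simps)
qed

lemma det_submatrix_doubleton:
  assumes "i < j" "j < dim_row A" "k < l" "l < dim_col A"
  shows "Determinant.det (submatrix A {i, j} {k, l}) =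
    A $$ (i, k) * A $$ (j, l) - A $$ (i, l) * A $$ (j, k)"
proof -
  have "{i'. i' < dim_row A \<and> i' \<in> {i, j}} = {i, j}" "{k'. k' < dim_col A \<and> k' \<in> {k, l}} = {k, l}"
    using assms by auto
  then have c: "card {i'. i' < dim_row A \<and> i' \<in> {i, j}} = 2" "card {k'. k' < dim_col A \<and> k' \<in> {k, l}} = 2"
    using assms by auto
  have "submatrix A {i, j} {k, l} \<in> carrier_mat 2 2"
    using c by (auto simp: submatrix_def)
  then show ?thesis
    using assms c
    by (simp add: det_carrier_mat_2 submatrix_index pick_doubleton del: pick.simps)
qed

text \<open>A coordinate of the exterior product of \<open>d\<close> and \<open>e\<close>: the minor
  in rows \<open>i\<close>, \<open>j\<close> of the matrix with columns \<open>d\<close>,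
  \<open>e\<close>.\<close>

definition wedge :: "real ^ 'n \<Rightarrow> real ^ 'n \<Rightarrow> 'n \<Rightarrow> 'n \<Rightarrow> real" where
  "wedge d e i j = d $ i * e $ j - e $ i * d $ j"

text \<open>The only column pair is 01 and the row pairs in lexicographic order are 01, 02, 12,
  which yields the coordinates z, u, v in this order.\<close>

lemma col_mult_compound_2_mat_of_states:
  fixes \<delta> :: "nat \<Rightarrow> real ^ 3"
  shows "col (mult_compound 2 (mat_of_states 2 \<delta>)) 0 =
    vec_of_list [wedge (\<delta> 0) (\<delta> 1) 0 1, wedge (\<delta> 0) (\<delta> 1) 0 2, wedge (\<delta> 0) (\<delta> 1) 1 2]"
    (is "?l = ?r")
proof (rule eq_vecI)
  define A where "A = mat_of_states 2 \<delta>"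
  have dim: "dim_row A = 3" "dim_col A = 2"
    by (simp_all add: A_def mat_of_states_def)
  have A: "A $$ (i, j) = \<delta> j $ ([0, 1, 2] ! i)" if "i < 3" "j < 2" for i j
    using that by (simp add: A_def mat_of_states_def sorted_list_of_set_3)
  have choose: "3 choose 2 = (3::nat)" by (simp add: choose_two)
  show "dim_vec ?l = dim_vec ?r"
    using choose by (simp add: mult_compound_def mat_of_states_def)
  fix i assume "i < dim_vec ?r"
  then have i: "i < 3" by simp
  have "vec_index ?l i =
      Determinant.det (submatrix A (set ([[0, 1], [0, 2], [1, 2]] ! i)) {0, 1})"
    using i choose unfolding A_def[symmetric]
    by (simp add: mult_compound_def dim lex_subsets_2_2 lex_subsets_3_2)
  moreover from i have "i = 0 \<or> i = 1 \<or> i = 2" by linarith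
  ultimately show "vec_index ?l i = vec_index ?r i"
    by (elim disjE) (simp_all add: det_submatrix_doubleton dim A wedge_def numeral_2_eq_2)
qed

lemma weighted_norm_carrier_vec_3:
  assumes "b > 0"
  shows "is_norm_on_carrier_vec 3
    (\<lambda>v. sqrt (b * (vec_index v 0)\<^sup>2 + (vec_index v 1)\<^sup>2 + (vec_index v 2)\<^sup>2))"
proof -
  \<comment> \<open>An injective linear map into a product space with Euclidean norm; the norm
    axioms are pulled back along it.\<close>
  define f where "f v = (sqrt b * vec_index v 0, vec_index v 1, vec_index v 2)" for v
  have eq: "sqrt (b * (vec_index v 0)\<^sup>2 + (vec_index v 1)\<^sup>2 + (vec_index v 2)\<^sup>2) = norm (f v)" for v
    using assms by (simp add: f_def norm_Pair power_mult_distrib add.assoc)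
  have "f v = 0 \<longleftrightarrow> v = 0\<^sub>v 3" if "v \<in> carrier_vec 3" for v
    using that assms by (auto simp: f_def zero_prod_def numeral_3_eq_3 numeral_2_eq_2 less_Suc_eq)
  moreover have "f (c \<cdot>\<^sub>v v) = c *\<^sub>R f v" if "v \<in> carrier_vec 3" for c v
    using that by (simp add: f_def)
  moreover have "f (v + w) = f v + f w" if "v \<in> carrier_vec 3" "w \<in> carrier_vec 3" for v w
    using that by (simp add: f_def algebra_simps)
  ultimately show ?thesis
    unfolding is_norm_on_carrier_vec_def eq by (simp add: norm_triangle_ineq)
qed

text \<open>The Jacobian at \<open>x\<close> applied to \<open>h\<close>, in closed form, so that
  the variational equation can be read off by coordinates.\<close>

definition two_bus_derivative where
  "two_bus_derivative M1 M2 R1 R2 a \<phi> x h =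
     (\<chi> i. if i = 0 then - (R1 / M1) * h $ 0 - a * cos (x $ 2 + \<phi>) / M1 * h $ 2
          else if i = 1 then - (R2 / M2) * h $ 1 + a * cos (x $ 2 - \<phi>) / M2 * h $ 2
          else h $ 1 - h $ 0 :: real ^ 3)"

lemma has_derivative_two_bus:
  "(two_bus M1 M2 R1 R2 p1 p2 a \<phi> has_derivative two_bus_derivative M1 M2 R1 R2 a \<phi> x) (at x)"
proof (subst has_derivative_componentwise_within, intro ballI)
  fix b :: "real ^ 3" assume "b \<in> Basis"
  then obtain i where b: "b = axis i 1" by (auto simp: Basis_vec_def)
  have nth: "((\<lambda>x. x $ j) has_derivative (\<lambda>h. h $ j)) (at x)" for j :: 3 and x :: "real ^ 3"
    by (rule bounded_linear_imp_has_derivative) (rule bounded_linear_vec_nth)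
  have eq: "two_bus M1 M2 R1 R2 p1 p2 a \<phi> y \<bullet> b = two_bus M1 M2 R1 R2 p1 p2 a \<phi> y $ i"
    "two_bus_derivative M1 M2 R1 R2 a \<phi> x y \<bullet> b = two_bus_derivative M1 M2 R1 R2 a \<phi> x y $ i" for y
    by (simp_all add: b inner_axis)
  show "((\<lambda>x. two_bus M1 M2 R1 R2 p1 p2 a \<phi> x \<bullet> b) has_derivative
      (\<lambda>h. two_bus_derivative M1 M2 R1 R2 a \<phi> x h \<bullet> b)) (at x)"
    unfolding eq unfolding two_bus_def two_bus_derivative_def vec_lambda_beta
    by (cases "i = 0"; cases "i = 1"; simp add: divide_inverse;
        (rule nth derivative_eq_intros refl)+; simp add: algebra_simps)
qed

text \<open>Both sides are Frechet derivatives at \<open>x\<close>, and these are unique.\<close>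

lemma jacobian_two_bus:
  "jacobian (two_bus M1 M2 R1 R2 p1 p2 a \<phi>) (at x) *v h = two_bus_derivative M1 M2 R1 R2 a \<phi> x h"
  using has_derivative_unique[OF has_derivative_two_bus] jacobian_works has_derivative_two_bus
  unfolding differentiable_def by metis

lemma two_bus_solution_derivatives:
  assumes "is_solution_on (\<lambda>t y. jacobian (two_bus M1 M2 R1 R2 p1 p2 a \<phi>) (at (x t)) *v y) UNIV s T d"
    and "t \<in> {s..T}"
  shows "((\<lambda>t. d t $ i) has_real_derivative two_bus_derivative M1 M2 R1 R2 a \<phi> (x t) (d t) $ i)
    (at t within {s..T})"
  using assms bounded_linear.has_vector_derivative[OF bounded_linear_vec_nth]
  unfolding is_solution_on_def jacobian_two_bus has_real_derivative_iff_has_vector_derivative by blast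

lemma lyapunov_derivative_le:
  fixes z u v b c1 c2 r1 r2 \<eta> :: real
  assumes b: "b > 0" and c: "\<bar>b * c1\<bar> \<le> 1" "\<bar>b * c2\<bar> \<le> 1"
    and r: "\<eta> > 0" "2 * \<eta> \<le> r1" "2 * \<eta> \<le> r2" "4 \<le> b * r1\<^sup>2" "4 \<le> b * r2\<^sup>2"
  shows "b * (2 * z * (- (r1 + r2) * z + c2 * u + c1 * v)) + 2 * u * (z - r1 * u) + 2 * v * (z - r2 * v)
    \<le> - (2 * \<eta>) * (b * z\<^sup>2 + u\<^sup>2 + v\<^sup>2)"
proof -
  \<comment> \<open>Half of a cross term of V': \<open>b * c\<close> comes from z' and 1 from u' or
    v'. Since c2 couples z to u, it is paired with the damping r1 of u, and c1 with r2.\<close>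
  have pair: "(b * c + 1) * (z * w) \<le> (r - \<eta>) * (b * z\<^sup>2 + w\<^sup>2)"
    if "\<bar>b * c\<bar> \<le> 1" "2 * \<eta> \<le> r" "4 \<le> b * r\<^sup>2" for c w r
  proof -
    have "2\<^sup>2 \<le> (sqrt b * r)\<^sup>2"
      using that b by (simp add: power_mult_distrib)
    then have "2 \<le> sqrt b * r"
      by (rule power2_le_imp_le) (use that r b in auto)
    \<comment> \<open>From \<open>2 * \<eta> \<le> r\<close>: keeping back \<eta> costs at most half
      of the damping.\<close>
    also have "\<dots> \<le> sqrt b * (2 * (r - \<eta>))"
      using that b by (intro mult_left_mono) auto
    also have "\<dots> = 2 * (sqrt b * (r - \<eta>))" by simp
    finally have k: "1 \<le> sqrt b * (r - \<eta>)" by linarith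
    have "(b * c + 1) * (z * w) \<le> \<bar>b * c + 1\<bar> * \<bar>z * w\<bar>"
      by (metis abs_ge_self abs_mult)
    also have "\<dots> \<le> 2 * \<bar>z * w\<bar>"
      using that by (intro mult_right_mono) auto
    also have "\<dots> \<le> 2 * (sqrt b * (r - \<eta>) * \<bar>z * w\<bar>)"
      using mult_right_mono[OF k, of "\<bar>z * w\<bar>"] by simp
    also have "\<dots> = (r - \<eta>) * (2 * (sqrt b * \<bar>z\<bar>) * \<bar>w\<bar>)"
      by (simp add: abs_mult)
    also have "\<dots> \<le> (r - \<eta>) * ((sqrt b * \<bar>z\<bar>)\<^sup>2 + \<bar>w\<bar>\<^sup>2)"
      using that r by (intro mult_left_mono sum_squares_bound) auto
    finally show ?thesis
      using b by (simp add: power_mult_distrib)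
  qed
  \<comment> \<open>Both pairs keep back \<eta> of the damping of z, twice what the claim needs;
    this term is the surplus, up to a factor 2.\<close>
  have "0 \<le> \<eta> * (b * z\<^sup>2)" using b r by simp
  with pair[OF c(2) r(2) r(4), of u] pair[OF c(1) r(3) r(5), of v] show ?thesis
    by (simp add: algebra_simps power2_eq_square)
qed

theorem corollary4:
  fixes M1 M2 R1 R2 p1 p2 a \<phi> :: real
  assumes "R1 > 0" and "R2 > 0" and "M1 > 0" and "M2 > 0" and "p1 > 0" and "p2 > 0" and "a > 0"
    and "- pi / 2 < \<phi>" and "\<phi> < pi / 2"
    and "a > max M1 M2"
    and "3 * a\<^sup>2 * (1 + \<bar>cos (2 * \<phi>)\<bar>) < min M1 M2 / max M1 M2 * min (R1\<^sup>2 / 2) (R2\<^sup>2 / 2)"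
  shows "k_contractive 2 (\<lambda>t. two_bus M1 M2 R1 R2 p1 p2 a \<phi>) UNIV"
proof -
  define b where "b = min M1 M2 / a"
  define \<eta> where "\<eta> = min (R1 / M1) (R2 / M2) / 2"
  define V where "V d e = b * (wedge d e 0 1)\<^sup>2 + (wedge d e 0 2)\<^sup>2 + (wedge d e 1 2)\<^sup>2"
    for d e :: "real ^ 3"
  define \<nu> where
    "\<nu> v = sqrt (b * (vec_index v 0)\<^sup>2 + (vec_index v 1)\<^sup>2 + (vec_index v 2)\<^sup>2)" for v
  have b: "b > 0" and \<eta>: "\<eta> > 0" using assms by (simp_all add: b_def \<eta>_def)
  have \<nu>_col: "\<nu> (col (mult_compound 2 (mat_of_states 2 \<delta>)) 0) = sqrt (V (\<delta> 0) (\<delta> 1))"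
    for \<delta> :: "nat \<Rightarrow> real ^ 3"
    unfolding \<nu>_def V_def col_mult_compound_2_mat_of_states by (simp add: numeral_2_eq_2)
  have coupling: "\<bar>b * (a * cos y / M)\<bar> \<le> 1" if "M \<in> {M1, M2}" for M y
  proof -
    have "0 < M" "min M1 M2 \<le> M" using that assms by auto
    have "\<bar>b * (a * cos y / M)\<bar> = min M1 M2 / M * \<bar>cos y\<bar>"
      using assms \<open>0 < M\<close> by (simp add: b_def abs_mult)
    moreover have "min M1 M2 / M * \<bar>cos y\<bar> \<le> 1 * 1"
      using \<open>0 < M\<close> \<open>min M1 M2 \<le> M\<close> by (intro mult_mono) auto
    ultimately show ?thesis by simp
  qed
  \<comment> \<open>The left factor of the hypothesis is at least 3 a^2, so 6 a^2 l < m R^2. With M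
    \<le> l < a also a M^2 \<le> a^2 l, hence b (R/M)^2 = m R^2 / (a M^2) exceeds even 6.\<close>
  have damping: "4 \<le> b * (R / M)\<^sup>2" if "(R, M) \<in> {(R1, M1), (R2, M2)}" for R M
  proof -
    define m where "m = min M1 M2"
    define l where "l = max M1 M2"
    have p: "0 < m" "0 < M" "M \<le> l" "l < a" using that assms by (auto simp: m_def l_def)
    have "3 * a\<^sup>2 \<le> 3 * a\<^sup>2 * (1 + \<bar>cos (2 * \<phi>)\<bar>)"
      by (simp add: algebra_simps)
    also have "\<dots> < m / l * min (R1\<^sup>2 / 2) (R2\<^sup>2 / 2)"
      using assms by (simp add: m_def l_def)
    also have "\<dots> \<le> m / l * (R\<^sup>2 / 2)"
      using that p by (intro mult_left_mono) auto
    finally have "6 * a\<^sup>2 * l < m * R\<^sup>2"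
      using p by (simp add: field_simps)
    moreover have "a * M\<^sup>2 \<le> a\<^sup>2 * l"
      using mult_mono[of M a M l] p assms by (simp add: power2_eq_square)
    moreover have "0 \<le> a\<^sup>2 * l" using p by simp
    ultimately have "4 * (a * M\<^sup>2) \<le> m * R\<^sup>2" by simp
    then show ?thesis
      using p assms by (simp add: b_def m_def[symmetric] power_divide field_simps)
  qed
  have "k_contractive_with 2 (\<lambda>t. two_bus M1 M2 R1 R2 p1 p2 a \<phi>) UNIV \<eta> \<nu>"
    unfolding k_contractive_with_def \<nu>_col
  proof (intro allI impI ballI)
    fix s T t :: real and x :: "real \<Rightarrow> real ^ 3" and \<delta> :: "nat \<Rightarrow> real \<Rightarrow> real ^ 3"
    assume sol: "\<forall>j<2. is_solution_on
        (\<lambda>t y. jacobian (two_bus M1 M2 R1 R2 p1 p2 a \<phi>) (at (x t)) *v y) UNIV s T (\<delta> j)"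
      and t: "t \<in> {s..T}"
    have d0: "((\<lambda>t. \<delta> 0 t $ i) has_real_derivative
        two_bus_derivative M1 M2 R1 R2 a \<phi> (x r) (\<delta> 0 r) $ i) (at r within {s..T})"
      and d1: "((\<lambda>t. \<delta> 1 t $ i) has_real_derivative
        two_bus_derivative M1 M2 R1 R2 a \<phi> (x r) (\<delta> 1 r) $ i) (at r within {s..T})"
      if "r \<in> {s..T}" for i r
      using sol two_bus_solution_derivatives that by (metis pos2, metis one_less_numeral_iff semiring_norm(76))
    define z where "z r = wedge (\<delta> 0 r) (\<delta> 1 r) 0 1" for r
    define u where "u r = wedge (\<delta> 0 r) (\<delta> 1 r) 0 2" for r
    define v where "v r = wedge (\<delta> 0 r) (\<delta> 1 r) 1 2" for r
    define c1 where "c1 r = a * cos (x r $ 2 + \<phi>) / M1" for r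
    define c2 where "c2 r = a * cos (x r $ 2 - \<phi>) / M2" for r
    have V: "V (\<delta> 0 r) (\<delta> 1 r) = b * (z r)\<^sup>2 + (u r)\<^sup>2 + (v r)\<^sup>2" for r
      by (simp add: V_def z_def u_def v_def)
    \<comment> \<open>By the product rule (z, u, v) evolves under the second additive compound of
      the Jacobian. In u' and v' the cosine terms cancel, being multiples of the wedge of index 2
      with itself.\<close>
    have z': "(z has_real_derivative - (R1 / M1 + R2 / M2) * z r + c2 r * u r + c1 r * v r)
        (at r within {s..T})" if "r \<in> {s..T}" for r
      unfolding z_def u_def v_def wedge_def
      by (rule derivative_eq_intros d0 d1 that refl)+
        (simp add: two_bus_derivative_def c1_def c2_def algebra_simps)
    have u': "(u has_real_derivative z r - R1 / M1 * u r) (at r within {s..T})"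
      if "r \<in> {s..T}" for r
      unfolding z_def u_def wedge_def
      by (rule derivative_eq_intros d0 d1 that refl)+
        (simp add: two_bus_derivative_def algebra_simps)
    have v': "(v has_real_derivative z r - R2 / M2 * v r) (at r within {s..T})"
      if "r \<in> {s..T}" for r
      unfolding z_def v_def wedge_def
      by (rule derivative_eq_intros d0 d1 that refl)+
        (simp add: two_bus_derivative_def algebra_simps)
    have "V (\<delta> 0 t) (\<delta> 1 t) \<le> exp (- (2 * \<eta>) * (t - s)) * V (\<delta> 0 s) (\<delta> 1 s)"
      unfolding V
    proof (rule decay_of_derivative_le[OF _ lyapunov_derivative_le t])
      fix r assume r: "r \<in> {s..T}"
      show "((\<lambda>r. b * (z r)\<^sup>2 + (u r)\<^sup>2 + (v r)\<^sup>2) has_real_derivative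
          b * (2 * z r * (- (R1 / M1 + R2 / M2) * z r + c2 r * u r + c1 r * v r))
          + 2 * u r * (z r - R1 / M1 * u r) + 2 * v r * (z r - R2 / M2 * v r)) (at r within {s..T})"
        by (rule derivative_eq_intros z'[OF r] u'[OF r] v'[OF r] refl)+ simp
    qed (use b \<eta> coupling damping in \<open>auto simp: c1_def c2_def \<eta>_def\<close>)
    \<comment> \<open>The norm is the square root of V, so the rate \<open>2 * \<eta>\<close> of V
      becomes \<eta>.\<close>
    then have "sqrt (V (\<delta> 0 t) (\<delta> 1 t)) \<le> sqrt ((exp (- \<eta> * (t - s)))\<^sup>2 * V (\<delta> 0 s) (\<delta> 1 s))"
      by (simp add: mult.assoc flip: exp_double)
    then show "sqrt (V (\<delta> 0 t) (\<delta> 1 t)) \<le> exp (- \<eta> * (t - s)) * sqrt (V (\<delta> 0 s) (\<delta> 1 s))"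
      by (simp add: real_sqrt_mult)
  qed
  moreover have "is_norm_on_carrier_vec (CARD(3) choose 2) \<nu>"
    using weighted_norm_carrier_vec_3[OF b] unfolding \<nu>_def by (simp add: choose_two)
  ultimately show ?thesis
    using \<eta> unfolding k_contractive_def by auto
qed

end
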